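(* Let $T$ be a finite tree with at least two vertices. Then $\gamma_{\mathrm{m}}^{\infty}(T)=\theta(T)$ if and only if the reduction R2 can be applied repeatedly (zero or more times) to $T$ to obtain a star $K_{1,r}$ with $r\in\{1,2\}$.
   Context: All graphs are finite, simple and undirected. A dominating set of $G=(V,E)$ is a set $D\subseteq V$ such that every vertex of $V-D$ is adjacent to a vertex of $D$. m-eternal domination ("all guards move"): a defender chooses a set $D_1\subseteq V$ and places one guard on each vertex of $D_1$. Then, for $i=1,2,\ldots$ in turn, an attacker (knowing the current position) chooses a vertex $r_i\in V-D_i$, and the defender responds with a set $D_{i+1}$ with $|D_{i+1}|=|D_i|$ and $r_i\in D_{i+1}$, obtained from $D_i$ by letting each guard either stay in place or move to an adjacent vertex (i.e. there is a bijection $f:D_i\to D_{i+1}$ with $f(v)=v$ or $f(v)$ adjacent to $v$ for each $v\in D_i$). Every $D_i$ must be a dominating set. $D_1$ is an m-eternal dominating set if the defender, starting from $D_1$, can respond in this way forever to every infinite sequence of attacks. $\gamma_{\mathrm{m}}^{\infty}(G)$ is the minimum size of an m-eternal dominating set of $G$. The clique covering number $\theta(G)$ is the minimum number $k$ of sets in a partition $V=V_1\cup\cdots\cup V_k$ such that each induced subgraph $G[V_i]$ is complete. In a tree, a leaf is a vertex of degree one and a stem is a vertex adjacent to a leaf. Reduction R2: let $x$ be a stem of degree two in $T$ such that $x$ is adjacent to exactly one leaf, $y$; delete both $x$ and $y$ (the result is again a tree). *)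

theory Defs
  imports "Graph_Theory.Graph_Theory" "HOL-Library.Disjoint_Sets"
begin

text \<open>
  Finite simple undirected graphs are the symmetric digraphs of the locale \<^locale>\<open>graph\<close>.
  Every edge is represented by a pair of opposite arcs, so adjacency is \<open>u \<rightarrow>\<^bsub>G\<^esub> v\<close> and the
  degree of a vertex is its out-degree.
\<close>

text \<open>
  \<^const>\<open>tree\<close> is unsuitable here: it excludes all directed cycles, and traversing an edge back
  and forth is a directed cycle of length 2. In a simple graph represented by a symmetric
  digraph, the undirected cycles are the directed cycles of length at least 3.
\<close>

definition undirected_tree :: "('a, 'b) pre_digraph \<Rightarrow> bool" where
  "undirected_tree T \<longleftrightarrow>
     graph T \<and> connected T \<and> \<not> (\<exists>p. pre_digraph.cycle T p \<and> length p \<ge> 3)"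

definition dominating_set :: "('a, 'b) pre_digraph \<Rightarrow> 'a set \<Rightarrow> bool" where
  "dominating_set G D \<longleftrightarrow>
     D \<subseteq> verts G \<and> (\<forall>v \<in> verts G - D. \<exists>u \<in> D. v \<rightarrow>\<^bsub>G\<^esub> u)"

definition guard_move :: "('a, 'b) pre_digraph \<Rightarrow> 'a set \<Rightarrow> 'a set \<Rightarrow> bool" where
  "guard_move G D D' \<longleftrightarrow>
     (\<exists>f. bij_betw f D D' \<and> (\<forall>v \<in> D. f v = v \<or> v \<rightarrow>\<^bsub>G\<^esub> f v))"

text \<open>
  A strategy \<open>\<sigma>\<close> of the defender maps the list of attacks made so far to the current position of
  the guards, so that \<open>\<sigma> (map r [0..<i])\<close> is the position after the first \<open>i\<close> attacks of the
  sequence \<open>r\<close>. The defender is only obliged to answer as long as the attacks are legal,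
  that is, each one is on an unguarded vertex of the position at that time. Legality is required
  only of the attacks made so far, because the attacker has no legal attack if all vertices
  are guarded.
\<close>

definition m_eternal_dominating_set :: "('a, 'b) pre_digraph \<Rightarrow> 'a set \<Rightarrow> bool" where
  "m_eternal_dominating_set G D\<^sub>1 \<longleftrightarrow>
     (\<exists>\<sigma> :: 'a list \<Rightarrow> 'a set. \<sigma> [] = D\<^sub>1 \<and>
        (\<forall>r :: nat \<Rightarrow> 'a. let D = (\<lambda>i. \<sigma> (map r [0..<i])) in
           \<forall>i. (\<forall>j < i. r j \<in> verts G - D j) \<longrightarrow>
             dominating_set G (D i) \<and>
             (r i \<in> verts G - D i \<longrightarrow> guard_move G (D i) (D (Suc i)) \<and> r i \<in> D (Suc i))))"

definition m_eternal_domination_number :: "('a, 'b) pre_digraph \<Rightarrow> nat" (\<open>\<gamma>\<^sub>m\<^sup>\<infinity>\<close>) where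
  "\<gamma>\<^sub>m\<^sup>\<infinity> G = (LEAST k. \<exists>D. m_eternal_dominating_set G D \<and> card D = k)"

definition clique_cover :: "('a, 'b) pre_digraph \<Rightarrow> 'a set set \<Rightarrow> bool" where
  "clique_cover G P \<longleftrightarrow>
     partition_on (verts G) P \<and> (\<forall>W \<in> P. complete_digraph (card W) (G \<restriction> W))"

definition clique_covering_number :: "('a, 'b) pre_digraph \<Rightarrow> nat" (\<open>\<theta>\<close>) where
  "\<theta> G = (LEAST k. \<exists>P. clique_cover G P \<and> card P = k)"

definition leaf :: "('a, 'b) pre_digraph \<Rightarrow> 'a \<Rightarrow> bool" where
  "leaf G v \<longleftrightarrow> v \<in> verts G \<and> out_degree G v = 1"

definition stem :: "('a, 'b) pre_digraph \<Rightarrow> 'a \<Rightarrow> bool" where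
  "stem G v \<longleftrightarrow> v \<in> verts G \<and> (\<exists>u. leaf G u \<and> v \<rightarrow>\<^bsub>G\<^esub> u)"

inductive R2 :: "('a, 'b) pre_digraph \<Rightarrow> ('a, 'b) pre_digraph \<Rightarrow> bool" where
  R2: "\<lbrakk> stem G x; out_degree G x = 2; {u. leaf G u \<and> x \<rightarrow>\<^bsub>G\<^esub> u} = {y} \<rbrakk>
       \<Longrightarrow> R2 G (G \<restriction> (verts G - {x, y}))"

end

theory Submission
  imports Defs "HOL-Library.Multiset"
begin

text \<open>
  Both sides of the equivalence say that \<open>T\<close> has a clique cover by edges and at most one single
  vertex, i.e. that \<open>\<theta> T\<close> is \<open>n / 2\<close> rounded up, where \<open>n\<close> is the number of vertices.

  On the one hand, \<open>\<gamma>\<^sub>m\<^sup>\<infinity> T\<close> never exceeds \<open>n / 2\<close> rounded up: below a parent of deepest leaves one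
  can remove either at least two leaves or an edge at the cost of one guard. So equality forces such
  a cover; rooting \<open>T\<close> at the single vertex (if there is one), a deepest leaf and its parent form a
  block of the cover, and R2 removes this block until only \<open>K\<^bsub>1,1\<^esub>\<close> or \<open>K\<^bsub>1,2\<^esub>\<close> is left.

  On the other hand, each R2 step lowers the number of guards needed by at least one, and that of
  cliques needed by at most one. This lower bound is proved for a relaxed game in which several
  guards may share a vertex, because the projection of a position to the reduced tree need not be
  injective. Positions are therefore multisets, and a move is a relation lifted by
  \<^const>\<open>rel_mset\<close>.
\<close>

subsection \<open>The guarding game on an abstract relation\<close>

abbreviation stay_or_step :: "('a \<Rightarrow> 'a \<Rightarrow> bool) \<Rightarrow> 'a \<Rightarrow> 'a \<Rightarrow> bool" where
  "stay_or_step E \<equiv> \<lambda>u v. u = v \<or> E u v"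

text \<open>Bridges two descriptions of a move. A bijection carries the multiset of guards onto the
  new one; conversely, induction on \<open>D\<close> splits off one guard \<open>a\<close>, and its
  partner \<open>b\<close> in the lifted relation becomes the value of \<open>f\<close> at
  \<open>a\<close>.\<close>

lemma rel_mset_mset_set_iff_bij_betw:
  assumes "finite D"
  shows "(\<exists>f. bij_betw f D D' \<and> (\<forall>v\<in>D. R v (f v))) \<longleftrightarrow>
    finite D' \<and> rel_mset R (mset_set D) (mset_set D')"
proof
  assume "\<exists>f. bij_betw f D D' \<and> (\<forall>v\<in>D. R v (f v))"
  then obtain f where f: "bij_betw f D D'" "\<forall>v\<in>D. R v (f v)" by blast
  have "rel_mset (\<lambda>u v. R u (f v)) (mset_set D) (mset_set D)"
    using f(2) assms by (intro multiset.rel_refl_strong) auto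
  then have "rel_mset R (mset_set D) (image_mset f (mset_set D))"
    by (simp add: multiset.rel_map)
  moreover have "image_mset f (mset_set D) = mset_set D'"
    using f(1) by (simp add: bij_betw_def image_mset_mset_set)
  ultimately show "finite D' \<and> rel_mset R (mset_set D) (mset_set D')"
    using f(1) assms bij_betw_finite by auto
next
  assume "finite D' \<and> rel_mset R (mset_set D) (mset_set D')"
  with assms show "\<exists>f. bij_betw f D D' \<and> (\<forall>v\<in>D. R v (f v))"
  proof (induction D arbitrary: D' rule: finite_induct)
    case empty
    then show ?case by (auto simp: mset_set_empty_iff bij_betw_def)
  next
    case (insert a D)
    from insert.hyps insert.prems have "rel_mset R (add_mset a (mset_set D)) (mset_set D')"
      by simp
    then obtain N b where N: "mset_set D' = add_mset b N" "R a b" "rel_mset R (mset_set D) N"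
      using msed_rel_invL by metis
    have "b \<in> D'"
      using N(1) insert.prems by (metis finite_set_mset_mset_set union_single_eq_member)
    then have "N = mset_set (D' - {b})"
      using N(1) insert.prems
      by (metis add_mset_remove_trivial mset_set.remove)
    with N(3) insert.IH[of "D' - {b}"] insert.prems obtain f
      where f: "bij_betw f D (D' - {b})" "\<forall>v\<in>D. R v (f v)" by auto
    have "bij_betw (f(a := b)) D (D' - {b})"
      using f(1) insert.hyps by (subst bij_betw_cong[of _ _ f]) auto
    then have "bij_betw (f(a := b)) (D \<union> {a}) ((D' - {b}) \<union> {b})"
      by (rule bij_betw_combine) auto
    then have "bij_betw (f(a := b)) (insert a D) D'"
      using \<open>b \<in> D'\<close> by (simp add: insert_absorb)
    moreover have "\<forall>v\<in>insert a D. R v ((f(a := b)) v)"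
      using f(2) N(2) insert.hyps by auto
    ultimately show ?case by blast
  qed
qed

text \<open>An endless defence is encoded as a family \<open>F\<close> of positions closed under
  answers. Attacks on guarded vertices are included at no cost, since staying put answers them.
  Domination is implicit: an unguarded vertex can be entered in one move only from a
  neighbour.\<close>

definition guardable :: "('a \<Rightarrow> 'a \<Rightarrow> bool) \<Rightarrow> 'a set \<Rightarrow> nat \<Rightarrow> bool" where
  "guardable E V k \<longleftrightarrow> (\<exists>F. F \<noteq> {} \<and>
     (\<forall>D\<in>F. D \<subseteq> V \<and> finite D \<and> card D = k \<and>
       (\<forall>r\<in>V. \<exists>D'\<in>F. r \<in> D' \<and> rel_mset (stay_or_step E) (mset_set D) (mset_set D'))))"

text \<open>The same closure condition with multiplicities, so that the image of a position under a
  map identifying vertices is again a position.\<close>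

definition multi_guardable :: "('a \<Rightarrow> 'a \<Rightarrow> bool) \<Rightarrow> 'a set \<Rightarrow> nat \<Rightarrow> bool" where
  "multi_guardable E V k \<longleftrightarrow> (\<exists>F. F \<noteq> {} \<and>
     (\<forall>M\<in>F. set_mset M \<subseteq> V \<and> size M = k \<and>
       (\<forall>r\<in>V. \<exists>M'\<in>F. r \<in># M' \<and> rel_mset (stay_or_step E) M M')))"

lemma guardableI:
  assumes "F \<noteq> {}"
    and "\<And>D. D \<in> F \<Longrightarrow> D \<subseteq> V \<and> finite D \<and> card D = k"
    and "\<And>D r. D \<in> F \<Longrightarrow> r \<in> V \<Longrightarrow>
      \<exists>D'\<in>F. r \<in> D' \<and> rel_mset (stay_or_step E) (mset_set D) (mset_set D')"
  shows "guardable E V k"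
  using assms unfolding guardable_def by (intro exI[of _ F]) simp

lemma multi_guardableI:
  assumes "F \<noteq> {}"
    and "\<And>M. M \<in> F \<Longrightarrow> set_mset M \<subseteq> V \<and> size M = k"
    and "\<And>M r. M \<in> F \<Longrightarrow> r \<in> V \<Longrightarrow> \<exists>M'\<in>F. r \<in># M' \<and> rel_mset (stay_or_step E) M M'"
  shows "multi_guardable E V k"
  using assms unfolding multi_guardable_def by (intro exI[of _ F]) simp

lemma guardableE:
  assumes "guardable E V k"
  obtains F where "F \<noteq> {}"
    "\<And>D. D \<in> F \<Longrightarrow> D \<subseteq> V \<and> finite D \<and> card D = k"
    "\<And>D r. D \<in> F \<Longrightarrow> r \<in> V \<Longrightarrow>
      \<exists>D'\<in>F. r \<in> D' \<and> rel_mset (stay_or_step E) (mset_set D) (mset_set D')"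
proof -
  from assms obtain F where F: "F \<noteq> {}" "\<forall>D\<in>F. D \<subseteq> V \<and> finite D \<and> card D = k \<and>
      (\<forall>r\<in>V. \<exists>D'\<in>F. r \<in> D' \<and> rel_mset (stay_or_step E) (mset_set D) (mset_set D'))"
    unfolding guardable_def by (elim exE conjE)
  show thesis by (rule that[of F]) (use F in simp_all)
qed

lemma multi_guardableE:
  assumes "multi_guardable E V k"
  obtains F where "F \<noteq> {}"
    "\<And>M. M \<in> F \<Longrightarrow> set_mset M \<subseteq> V \<and> size M = k"
    "\<And>M r. M \<in> F \<Longrightarrow> r \<in> V \<Longrightarrow> \<exists>M'\<in>F. r \<in># M' \<and> rel_mset (stay_or_step E) M M'"
proof -
  from assms obtain F where F: "F \<noteq> {}" "\<forall>M\<in>F. set_mset M \<subseteq> V \<and> size M = k \<and>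
      (\<forall>r\<in>V. \<exists>M'\<in>F. r \<in># M' \<and> rel_mset (stay_or_step E) M M')"
    unfolding multi_guardable_def by (elim exE conjE)
  show thesis by (rule that[of F]) (use F in simp_all)
qed

section \<open>Building strategies from those on smaller vertex sets\<close>

lemma guardable_empty: "guardable E {} 0"
  by (rule guardableI[of "{{}}"]) auto

text \<open>One guard holds \<open>W\<close> alone, as it reaches any vertex of the clique in one
  step. It rests while the old strategy answers attacks in \<open>V\<close>, and vice versa.\<close>

lemma guardable_add_clique:
  assumes "guardable E V k" "W \<noteq> {}" "V \<inter> W = {}"
    and clique: "\<And>u v. u \<in> W \<Longrightarrow> v \<in> W \<Longrightarrow> u \<noteq> v \<Longrightarrow> E u v"
  shows "guardable E (V \<union> W) (Suc k)"
proof -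
  obtain F where F: "F \<noteq> {}"
    "\<And>D. D \<in> F \<Longrightarrow> D \<subseteq> V \<and> finite D \<and> card D = k"
    "\<And>D r. D \<in> F \<Longrightarrow> r \<in> V \<Longrightarrow>
      \<exists>D'\<in>F. r \<in> D' \<and> rel_mset (stay_or_step E) (mset_set D) (mset_set D')"
    by (rule guardableE[OF assms(1)]) (rule that)
  define F' where "F' = {insert e D | e D. e \<in> W \<and> D \<in> F}"
  have step: "rel_mset (stay_or_step E) (mset_set (insert e D)) (mset_set (insert e' D'))"
    if "D \<in> F" "D' \<in> F" "e \<in> W" "e' \<in> W"
      "rel_mset (stay_or_step E) (mset_set D) (mset_set D')" for e e' D D'
  proof -
    have "e \<notin> D" "e' \<notin> D'" "finite D" "finite D'" using that F(2) assms(3) by blast+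
    then show ?thesis using that clique by (auto intro!: rel_mset_Plus)
  qed
  have answer: "\<exists>D'\<in>F'. r \<in> D' \<and> rel_mset (stay_or_step E) (mset_set (insert e D)) (mset_set D')"
    if D: "D \<in> F" "e \<in> W" "r \<in> V \<union> W" for D e r
  proof (cases "r \<in> V")
    case True
    then obtain D' where "D' \<in> F" "r \<in> D'" "rel_mset (stay_or_step E) (mset_set D) (mset_set D')"
      using F(3) D(1) by blast
    then show ?thesis using step[of D D' e e] D unfolding F'_def by blast
  next
    case False
    have "rel_mset (stay_or_step E) (mset_set D) (mset_set D)"
      by (simp add: multiset.rel_refl)
    then show ?thesis using step[of D D e r] D False unfolding F'_def by blast
  qed
  have bounds: "insert e D \<subseteq> V \<union> W \<and> finite (insert e D) \<and> card (insert e D) = Suc k"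
    if "D \<in> F" "e \<in> W" for D e
  proof -
    have "e \<notin> D" using that F(2) assms(3) by blast
    then show ?thesis using that F(2) by auto
  qed
  have "F' \<noteq> {}" using F(1) assms(2) unfolding F'_def by blast
  show ?thesis
  proof (rule guardableI[of F'])
    fix X assume "X \<in> F'"
    then obtain e D where X: "X = insert e D" "D \<in> F" "e \<in> W" unfolding F'_def by blast
    show "X \<subseteq> V \<union> W \<and> finite X \<and> card X = Suc k"
      using bounds[OF X(2,3)] X(1) by simp
    show "\<exists>D'\<in>F'. r \<in> D' \<and> rel_mset (stay_or_step E) (mset_set X) (mset_set D')"
      if "r \<in> V \<union> W" for r
      using answer[OF X(2,3) that] X(1) by simp
  qed fact
qed

text \<open>
  The extra guard protects \<open>x\<close> whenever the given strategy leaves \<open>x\<close> unguarded, and waits on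
  one of the new leaves otherwise; so \<open>x\<close> is always guarded, and a guard on \<open>x\<close> can answer an
  attack on any leaf.
\<close>

lemma guardable_add_pendants:
  assumes "guardable E V k" "x \<in> V" "L \<noteq> {}" "V \<inter> L = {}"
    and pendant: "\<And>u. u \<in> L \<Longrightarrow> E u x \<and> E x u"
  shows "guardable E (V \<union> L) (Suc k)"
proof -
  obtain F where F: "F \<noteq> {}"
    "\<And>D. D \<in> F \<Longrightarrow> D \<subseteq> V \<and> finite D \<and> card D = k"
    "\<And>D r. D \<in> F \<Longrightarrow> r \<in> V \<Longrightarrow>
      \<exists>D'\<in>F. r \<in> D' \<and> rel_mset (stay_or_step E) (mset_set D) (mset_set D')"
    by (rule guardableE[OF assms(1)]) (rule that)
  \<comment> \<open>The admissible places for the extra guard \<open>e\<close>, given the old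
    position \<open>D\<close>; they lie outside \<open>D\<close>.\<close>
  define ok where "ok e D \<longleftrightarrow> (if x \<in> D then e \<in> L else e = x)" for e D
  define F' where "F' = {insert e D | e D. ok e D \<and> D \<in> F}"
  have fresh: "e \<notin> D" if "D \<in> F" "ok e D" for e D
  proof -
    have "D \<subseteq> V" using that F(2) by blast
    then show ?thesis using that assms(4) unfolding ok_def by (auto split: if_splits)
  qed
  have step: "rel_mset (stay_or_step E) (mset_set (insert e D)) (mset_set (insert e' D'))"
    if "D \<in> F" "D' \<in> F" "ok e D" "ok e' D'" "e = e' \<or> E e e'"
      "rel_mset (stay_or_step E) (mset_set D) (mset_set D')" for e e' D D'
  proof -
    have "finite D" "finite D'" using that F(2) by blast+
    then show ?thesis using that fresh by (auto intro!: rel_mset_Plus)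
  qed
  have answer: "\<exists>D'\<in>F'. r \<in> D' \<and> rel_mset (stay_or_step E) (mset_set (insert e D)) (mset_set D')"
    if D: "D \<in> F" "ok e D" and r: "r \<in> V \<union> L" for D e r
  proof (cases "r \<in> V")
    case True
    then obtain D' where D': "D' \<in> F" "r \<in> D'"
      "rel_mset (stay_or_step E) (mset_set D) (mset_set D')"
      using F(3) D(1) by blast
    obtain e' where "ok e' D'" "e = e' \<or> E e e'"
    proof (cases "x \<in> D \<longleftrightarrow> x \<in> D'")
      case True
      then show ?thesis using that[of e] D(2) by (auto simp: ok_def)
    next
      \<comment> \<open>The old strategy enters or leaves \<open>x\<close>, so the extra guard
        changes between \<open>x\<close> and a leaf, which is a single step.\<close>
      case False
      then show ?thesis
        using that[of x] that[of "SOME l. l \<in> L"] D(2) pendant assms(3)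
        by (auto simp: ok_def some_in_eq split: if_splits)
    qed
    then have "insert e' D' \<in> F'"
        "rel_mset (stay_or_step E) (mset_set (insert e D)) (mset_set (insert e' D'))"
      using step[of D D' e e'] D D' unfolding F'_def by blast+
    then show ?thesis using D'(2) by blast
  next
    case False
    then have r: "r \<in> L" using r by blast
    show ?thesis
    proof (cases "x \<in> D")
      \<comment> \<open>The guard on \<open>x\<close> takes the attacked leaf and the extra guard
        moves from \<open>e\<close> to \<open>x\<close>. In effect \<open>e\<close> is exchanged for
        \<open>r\<close>.\<close>
      case True
      then have e: "e \<in> L" using D(2) by (simp add: ok_def)
      define D0 where "D0 = D - {x}"
      have D0: "D = insert x D0" "x \<notin> D0" "finite D0" using True F(2) D(1) by (auto simp: D0_def)
      have "e \<notin> D" "r \<notin> D" using e r F(2) D(1) assms(4) by blast+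
      moreover have "rel_mset (stay_or_step E) (add_mset e (add_mset x (mset_set D0)))
          (add_mset x (add_mset r (mset_set D0)))"
        using e r pendant by (intro rel_mset_Plus multiset.rel_refl) auto
      ultimately have "rel_mset (stay_or_step E) (mset_set (insert e D)) (mset_set (insert r D))"
        using D0 by (simp add: add_mset_commute)
      moreover have "insert r D \<in> F'" using r D(1) True by (auto simp: F'_def ok_def)
      ultimately show ?thesis by blast
    next
      \<comment> \<open>The extra guard stands on \<open>x\<close>. The old strategy is fed an
        attack on \<open>x\<close>, which frees the extra guard to answer at
        \<open>r\<close>.\<close>
      case x: False
      then have "e = x" using D(2) by (simp add: ok_def)
      obtain D' where D': "D' \<in> F" "x \<in> D'"
        "rel_mset (stay_or_step E) (mset_set D) (mset_set D')"
        using F(3) D(1) assms(2) by blast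
      then have "ok r D'" using r by (simp add: ok_def)
      then have "insert r D' \<in> F'"
        "rel_mset (stay_or_step E) (mset_set (insert e D)) (mset_set (insert r D'))"
        using step[of D D' e r] D D' r pendant \<open>e = x\<close> unfolding F'_def by blast+
      then show ?thesis by blast
    qed
  qed
  have bounds: "insert e D \<subseteq> V \<union> L \<and> finite (insert e D) \<and> card (insert e D) = Suc k"
    if "D \<in> F" "ok e D" for D e
  proof -
    have "e \<notin> D" using that by (rule fresh)
    moreover have "e \<in> V \<union> L" using that(2) assms(2) by (auto simp: ok_def split: if_splits)
    ultimately show ?thesis using F(2)[OF that(1)] by auto
  qed
  have "F' \<noteq> {}"
  proof -
    obtain D l where "D \<in> F" "l \<in> L" using F(1) assms(3) by blast
    then have "insert (if x \<in> D then l else x) D \<in> F'"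
      unfolding F'_def ok_def by auto
    then show ?thesis by blast
  qed
  show ?thesis
  proof (rule guardableI[of F'])
    fix X assume "X \<in> F'"
    then obtain e D where X: "X = insert e D" "D \<in> F" "ok e D" unfolding F'_def by blast
    show "X \<subseteq> V \<union> L \<and> finite X \<and> card X = Suc k"
      using bounds[OF X(2,3)] X(1) by simp
    show "\<exists>D'\<in>F'. r \<in> D' \<and> rel_mset (stay_or_step E) (mset_set X) (mset_set D')"
      if "r \<in> V \<union> L" for r
      using answer[OF X(2,3) that] X(1) by simp
  qed fact
qed

text \<open>Every block gets a guard of its own, so the blocks can be added one by one.\<close>

lemma guardable_clique_partition:
  assumes "finite P" "partition_on V P"
    and "\<And>W u v. W \<in> P \<Longrightarrow> u \<in> W \<Longrightarrow> v \<in> W \<Longrightarrow> u \<noteq> v \<Longrightarrow> E u v"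
  shows "guardable E V (card P)"
  using assms
proof (induction P arbitrary: V rule: finite_induct)
  case empty
  then show ?case by (simp add: partition_on_def guardable_empty)
next
  case (insert W P)
  have "disjoint P" "V = \<Union>P \<union> W" "\<Union>P \<inter> W = {}" "W \<noteq> {}" "{} \<notin> P"
    using insert.prems(1) insert.hyps unfolding partition_on_def disjoint_def by auto
  moreover from this have "guardable E (\<Union>P) (card P)"
    using insert.prems(2) by (intro insert.IH) (auto simp: partition_on_def)
  ultimately have "guardable E (\<Union>P \<union> W) (Suc (card P))"
    using insert.prems(2)[of W] by (intro guardable_add_clique) simp_all
  then show ?case using \<open>V = \<Union>P \<union> W\<close> insert.hyps by simp
qed

section \<open>Rooted spanning trees and the upper bound on the number of guards\<close>

text \<open>A spanning tree given by parents \<open>p\<close> and depths \<open>d\<close>. Only the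
  edges to parents are demanded; further edges between vertices are permitted.\<close>

definition rooted_at :: "('a \<Rightarrow> 'a \<Rightarrow> bool) \<Rightarrow> 'a set \<Rightarrow> 'a \<Rightarrow> ('a \<Rightarrow> 'a) \<Rightarrow> ('a \<Rightarrow> nat) \<Rightarrow> bool" where
  "rooted_at E V s p d \<longleftrightarrow> finite V \<and> s \<in> V \<and> d s = 0 \<and>
     (\<forall>v\<in>V - {s}. p v \<in> V \<and> E v (p v) \<and> E (p v) v \<and> d v = Suc (d (p v)))"

lemma rooted_at_deepest:
  assumes "rooted_at E V s p d" "card V \<ge> 2"
  obtains y where "y \<in> V - {s}" "\<And>v. v \<in> V \<Longrightarrow> d v \<le> d y"
proof -
  have V: "finite V" "V \<noteq> {}" using assms unfolding rooted_at_def by auto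
  have "d ` V \<noteq> {}" using V by simp
  then obtain y where y: "y \<in> V" "d y = Max (d ` V)"
    using V by (metis (no_types, lifting) Max_in finite_imageI image_iff)
  then have max: "d v \<le> d y" if "v \<in> V" for v using that V by simp
  have "\<not> V \<subseteq> {s}" using assms(2) card_mono[of "{s}" V] by auto
  then obtain w where "w \<in> V - {s}" by blast
  then have "d y > 0" using max[of w] assms(1) unfolding rooted_at_def by auto
  then have "y \<noteq> s" using assms(1) unfolding rooted_at_def by auto
  then show ?thesis using that[of y] y max by blast
qed

lemma rooted_at_subset:
  assumes "rooted_at E V s p d" "s \<in> V'" "V' \<subseteq> V" "\<And>v. v \<in> V' \<Longrightarrow> v \<noteq> s \<Longrightarrow> p v \<in> V'"
  shows "rooted_at E V' s p d"
  using assms finite_subset[of V' V] unfolding rooted_at_def by auto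

text \<open>The inequality bounds \<open>k\<close> by half the number of vertices, rounded up. In
  the strong induction each step pays one guard for at least two vertices, taken from the bottom so
  that the rest is empty or still rooted at \<open>s\<close>.\<close>

lemma guardable_rooted:
  assumes "rooted_at E V s p d"
  shows "\<exists>k. 2 * k \<le> card V + 1 \<and> guardable E V k"
  using assms
proof (induction "card V" arbitrary: V rule: less_induct)
  case less
  note T = less.prems[unfolded rooted_at_def]
  show ?case
  proof (cases "card V \<ge> 2")
    case False
    then have "V = {s}" using T card_le_Suc0_iff_eq[of V] by auto
    then show ?thesis
      using guardable_add_clique[OF guardable_empty, of "{s}" E] by (intro exI[of _ 1]) auto
  next
    case True
    obtain y where y: "y \<in> V - {s}" and deepest: "\<And>v. v \<in> V \<Longrightarrow> d v \<le> d y"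
      using rooted_at_deepest[OF less.prems True] by blast
    define x where "x = p y"
    define C where "C = {v \<in> V - {s}. p v = x}"
    have C: "y \<in> C" "C \<subseteq> V" "s \<notin> C" "finite C" using y T by (auto simp: C_def x_def)
    have dy: "d y = Suc (d x)" and x: "x \<in> V" using y T by (auto simp: x_def)
    \<comment> \<open>A child of a vertex in \<open>C\<close> would be deeper than
      \<open>y\<close>.\<close>
    have childless: "p v \<notin> C" if v: "v \<in> V - {s}" for v
    proof
      assume "p v \<in> C"
      then have "d (p v) = Suc (d x)" using T unfolding C_def by blast
      then have "d v = Suc (d y)" using T v dy by simp
      then show False using deepest[of v] v by simp
    qed
    have x_notin: "x \<notin> C" using childless y x_def by blast
    show ?thesis
    proof (cases "C = {y}")
      \<comment> \<open>With several children, all of them are removed as pendants at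
        \<open>x\<close>, while \<open>x\<close> stays in the smaller tree.\<close>
      case False
      then obtain c where "c \<in> C" "c \<noteq> y" using C(1) by blast
      then have "card C \<ge> 2" using C card_mono[of C "{c, y}"] by simp
      moreover have card: "card V = card (V - C) + card C"
        using C T by (metis card_Diff_subset card_mono le_add_diff_inverse2)
      moreover have "rooted_at E (V - C) s p d"
      proof (rule rooted_at_subset[OF less.prems])
        show "p v \<in> V - C" if "v \<in> V - C" "v \<noteq> s" for v
          using childless[of v] T that by simp
      qed (use C T in auto)
      ultimately obtain k where k: "2 * k \<le> card (V - C) + 1" "guardable E (V - C) k"
        using less.hyps[of "V - C"] by auto
      have "guardable E (V - C \<union> C) (Suc k)"
      proof (rule guardable_add_pendants[where x = x])
        show "E u x \<and> E x u" if "u \<in> C" for u using T that unfolding C_def by blast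
      qed (use k x x_notin C in auto)
      moreover have "V - C \<union> C = V" using C by blast
      ultimately show ?thesis using k card \<open>card C \<ge> 2\<close> by (intro exI[of _ "Suc k"]) auto
    next
      case single: True
      have xy: "x \<noteq> y" "{x, y} \<subseteq> V" using x_notin C x by auto
      have edge: "E x y" "E y x" using y T by (auto simp: x_def)
      have card: "card V = card (V - {x, y}) + 2"
        using xy T card_Diff_subset[of "{x, y}" V] card_mono[of V "{x, y}"] by simp
      obtain k where k: "2 * k \<le> card (V - {x, y}) + 1" "guardable E (V - {x, y}) k"
      proof (cases "x = s")
        case True
        have "v \<in> C" if "v \<in> V - {s}" for v
        proof -
          have "d v \<le> 1" using deepest[of v] dy True T that by simp
          then have "d (p v) = 0" "p v \<in> V" using T that by auto
          then have "p v = s" using T by (metis Diff_iff Zero_not_Suc singletonD)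
          then show ?thesis using that True by (simp add: C_def)
        qed
        then have empty: "V - {x, y} = {}" using single True by auto
        show ?thesis using that[of 0] guardable_empty[of E] unfolding empty by simp
      next
        case False
        have "rooted_at E (V - {x, y}) s p d"
        proof (rule rooted_at_subset[OF less.prems])
          show "p v \<in> V - {x, y}" if "v \<in> V - {x, y}" "v \<noteq> s" for v
          proof -
            have "p v \<noteq> y" using childless[of v] single that by auto
            moreover have "p v \<noteq> x" using single that unfolding C_def by auto
            ultimately show ?thesis using T that by simp
          qed
        qed (use False y T in auto)
        then show ?thesis using less.hyps[of "V - {x, y}"] card that by auto
      qed
      have "guardable E (V - {x, y} \<union> {x, y}) (Suc k)"
        using k edge by (intro guardable_add_clique) auto
      moreover have "V - {x, y} \<union> {x, y} = V" using xy by blast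
      ultimately show ?thesis using k card by (intro exI[of _ "Suc k"]) auto
    qed
  qed
qed

section \<open>The effect of an R2 step on the number of guards\<close>

text \<open>
  Project the removed pair \<open>{x, y}\<close> onto \<open>z\<close> and delete one copy of \<open>z\<close>. A guard in \<open>{x, y}\<close>
  must be present to answer an attack on \<open>y\<close>, and it is projected onto \<open>z\<close> both before
  and after its move; hence deleting it leaves a legal move of the other guards.
\<close>

lemma multi_guardable_remove_pendant_path:
  assumes "multi_guardable E V k"
    and sym: "\<And>u v. E u v \<Longrightarrow> E v u"
    and V: "x \<in> V" "y \<in> V" "z \<in> V" and neq: "x \<noteq> z" "y \<noteq> z"
    and Ey: "\<And>u. E y u \<longleftrightarrow> u = x" and Ex: "\<And>u. E x u \<longleftrightarrow> u = y \<or> u = z"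
  shows "\<exists>k'. k = Suc k' \<and> multi_guardable E (V - {x, y}) k'"
proof -
  obtain F where F: "F \<noteq> {}"
    "\<And>M. M \<in> F \<Longrightarrow> set_mset M \<subseteq> V \<and> size M = k"
    "\<And>M r. M \<in> F \<Longrightarrow> r \<in> V \<Longrightarrow> \<exists>M'\<in>F. r \<in># M' \<and> rel_mset (stay_or_step E) M M'"
    by (rule multi_guardableE[OF assms(1)]) (rule that)
  define \<rho> where "\<rho> v = (if v = x \<or> v = y then z else v)" for v
  have \<rho>_step: "stay_or_step E (\<rho> u) (\<rho> v)" if "stay_or_step E u v" for u v
  proof -
    have "E v u" if "E u v" using sym that by blast
    \<comment> \<open>Edges touching \<open>x\<close> or \<open>y\<close> run inside
      \<open>{x, y, z}\<close>, so both ends project to \<open>z\<close>; all other edges are fixed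
      by \<open>\<rho>\<close>.\<close>
    then consider "u = v" | "E u v" "u \<in> {x, y}" "v \<in> {x, y, z}"
      | "E u v" "u \<in> {x, y, z}" "v \<in> {x, y}" | "E u v" "u \<notin> {x, y}" "v \<notin> {x, y}"
      using \<open>stay_or_step E u v\<close> Ex Ey by auto
    then show ?thesis by cases (simp_all add: \<rho>_def, auto)
  qed
  have proj: "rel_mset (stay_or_step E) (image_mset \<rho> M) (image_mset \<rho> M')"
    if "rel_mset (stay_or_step E) M M'" for M M'
    unfolding multiset.rel_map by (rule multiset.rel_mono_strong[OF that]) (rule \<rho>_step)
  \<comment> \<open>An attack on \<open>y\<close> can be answered only by a guard already on
    \<open>y\<close> or on its sole neighbour \<open>x\<close>.\<close>
  have guard: "\<exists>q M0. M = add_mset q M0 \<and> (q = x \<or> q = y)" if M: "M \<in> F" for M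
  proof -
    obtain M' where "y \<in># M'" "rel_mset (stay_or_step E) M M'"
      using F(3)[OF M V(2)] by blast
    moreover from \<open>y \<in># M'\<close> obtain N where "M' = add_mset y N" by (rule mset_add)
    ultimately have "rel_mset (stay_or_step E) M (add_mset y N)" by simp
    from msed_rel_invR[OF this] obtain q M0 where "M = add_mset q M0" "stay_or_step E q y"
      by blast
    then show ?thesis using sym[of q y] Ey by blast
  qed
  define F' where "F' = {A. \<exists>M\<in>F. image_mset \<rho> M = add_mset z A}"
  have "F' \<noteq> {}"
    using F(1) guard unfolding F'_def by (force simp: \<rho>_def)
  moreover have "set_mset A \<subseteq> V - {x, y} \<and> Suc (size A) = k" if A: "A \<in> F'" for A
  proof -
    obtain M where M: "M \<in> F" "image_mset \<rho> M = add_mset z A" using A unfolding F'_def by blast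
    have "set_mset A \<subseteq> \<rho> ` set_mset M"
      using arg_cong[OF M(2), of set_mset] by auto
    then have "set_mset A \<subseteq> V - {x, y}"
      using F(2)[OF M(1)] V neq unfolding \<rho>_def by auto
    moreover have "size M = Suc (size A)"
      using arg_cong[OF M(2), of size] by simp
    ultimately show ?thesis using F(2)[OF M(1)] by simp
  qed
  moreover have "\<exists>B\<in>F'. r \<in># B \<and> rel_mset (stay_or_step E) A B"
    if A: "A \<in> F'" and r: "r \<in> V - {x, y}" for A r
  proof -
    obtain M where M: "M \<in> F" "image_mset \<rho> M = add_mset z A" using A unfolding F'_def by blast
    obtain M' where M': "M' \<in> F" "r \<in># M'" "rel_mset (stay_or_step E) M M'"
      using F(3)[OF M(1)] r by blast
    obtain q M0 where q: "M = add_mset q M0" "q = x \<or> q = y" using guard[OF M(1)] by blast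
    have "rel_mset (stay_or_step E) (add_mset q M0) M'" using M'(3) q(1) by simp
    from msed_rel_invL[OF this] obtain q' M0' where q': "M' = add_mset q' M0'"
      "stay_or_step E q q'" "rel_mset (stay_or_step E) M0 M0'"
      by blast
    have "\<rho> q = z" "\<rho> q' = z" using q(2) q'(2) Ex Ey by (auto simp: \<rho>_def)
    then have A0: "A = image_mset \<rho> M0" and B: "image_mset \<rho> M' = add_mset z (image_mset \<rho> M0')"
      using M(2) q(1) q'(1) by simp_all
    have "r \<in># image_mset \<rho> M0'"
    proof (cases "r = z")
      \<comment> \<open>The deleted copy of \<open>z\<close> might be the guard that answers. But
        \<open>M'\<close> also has a guard \<open>t\<close> on \<open>x\<close> or \<open>y\<close>,
        which projects to a second copy of \<open>z\<close>.\<close>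
      case True
      obtain t M1 where t: "M' = add_mset t M1" "t = x \<or> t = y" using guard[OF M'(1)] by blast
      then have "z \<in># M1" using M'(2) True neq by auto
      moreover have "image_mset \<rho> M1 = image_mset \<rho> M0'" using B t by (auto simp: \<rho>_def)
      moreover have "\<rho> z = z" by (simp add: \<rho>_def)
      ultimately show ?thesis using True by (metis image_eqI set_image_mset)
    next
      case False
      have "\<rho> r = r" using r by (simp add: \<rho>_def)
      then have "r \<in># image_mset \<rho> M'" using M'(2) by (metis image_eqI set_image_mset)
      then show ?thesis using B False by simp
    qed
    moreover have "rel_mset (stay_or_step E) A (image_mset \<rho> M0')" using proj[OF q'(3)] A0 by simp
    ultimately show ?thesis using M'(1) B unfolding F'_def by blast
  qed
  moreover have "k = Suc (k - 1)" using calculation(1,2) by fastforce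
  ultimately show ?thesis
    by (intro exI[of _ "k - 1"] conjI multi_guardableI[of F']) auto
qed

subsection \<open>Domination and clique covering numbers\<close>

abbreviation adj :: "('a, 'b) pre_digraph \<Rightarrow> 'a \<Rightarrow> 'a \<Rightarrow> bool" where
  "adj G \<equiv> \<lambda>u v. u \<rightarrow>\<^bsub>G\<^esub> v"

lemma guard_move_iff_rel_mset:
  assumes "finite D"
  shows "guard_move G D D' \<longleftrightarrow>
    finite D' \<and> rel_mset (stay_or_step (adj G)) (mset_set D) (mset_set D')"
  unfolding rel_mset_mset_set_iff_bij_betw[OF assms, symmetric] guard_move_def
  by (simp add: eq_commute)

lemma dominates_induce_iff:
  "u \<rightarrow>\<^bsub>G \<restriction> W\<^esub> v \<longleftrightarrow> u \<in> W \<and> v \<in> W \<and> u \<rightarrow>\<^bsub>G\<^esub> v"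
  by (auto simp: arcs_ends_conv)

lemma (in graph) graph_induce_subgraph:
  assumes "W \<subseteq> verts G"
  shows "graph (G \<restriction> W)"
proof -
  have ind: "induced_subgraph (G \<restriction> W) G" using assms by (rule induced_induce)
  interpret H: digraph "G \<restriction> W" using ind by (rule digraphI_induced)
  interpret H: sym_digraph "G \<restriction> W" using ind by (rule induced_graph_imp_graph)
  show ?thesis by unfold_locales
qed

text \<open>The induced subgraph has vertex set \<open>W\<close> and no loops, so its completeness
  amounts to adjacency of distinct vertices.\<close>

lemma (in graph) clique_cover_iff:
  "clique_cover G P \<longleftrightarrow>
    partition_on (verts G) P \<and> (\<forall>W\<in>P. \<forall>u\<in>W. \<forall>v\<in>W. u \<noteq> v \<longrightarrow> u \<rightarrow>\<^bsub>G\<^esub> v)"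
proof -
  have "complete_digraph (card W) (G \<restriction> W) \<longleftrightarrow> (\<forall>u\<in>W. \<forall>v\<in>W. u \<noteq> v \<longrightarrow> u \<rightarrow>\<^bsub>G\<^esub> v)"
    if "W \<subseteq> verts G" for W
  proof -
    have "arcs_ends (G \<restriction> W) = {(u, v). u \<in> W \<and> v \<in> W \<and> u \<rightarrow>\<^bsub>G\<^esub> v}"
      using dominates_induce_iff[of _ _ G W] by auto
    then show ?thesis
      using graph_induce_subgraph[OF that] adj_not_same
      unfolding complete_digraph_def set_eq_iff by auto
  qed
  moreover have "W \<subseteq> verts G" if "partition_on (verts G) P" "W \<in> P" for W
    using that by (auto simp: partition_on_def)
  ultimately show ?thesis unfolding clique_cover_def by (metis (no_types, lifting))
qed

lemma (in graph) finite_clique_cover: "clique_cover G P \<Longrightarrow> finite P"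
  unfolding clique_cover_def by (blast intro: finite_elements finite_verts)

lemma clique_covering_number_le:
  "clique_cover G P \<Longrightarrow> \<theta> G \<le> card P"
  unfolding clique_covering_number_def by (rule Least_le) blast

text \<open>The singletons form a clique cover, so the least size is attained.\<close>

lemma (in graph) obtain_minimum_clique_cover:
  obtains P where "clique_cover G P" "card P = \<theta> G"
proof -
  have "clique_cover G ((\<lambda>v. {v}) ` verts G)"
    unfolding clique_cover_iff by (auto simp: partition_on_def disjoint_def)
  then have "\<exists>k P. clique_cover G P \<and> card P = k" by blast
  then show thesis using that LeastI_ex[of "\<lambda>k. \<exists>P. clique_cover G P \<and> card P = k"]
    unfolding clique_covering_number_def by blast
qed

lemma m_eternal_domination_number_le:
  "m_eternal_dominating_set G D \<Longrightarrow> \<gamma>\<^sub>m\<^sup>\<infinity> G \<le> card D"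
  unfolding m_eternal_domination_number_def by (rule Least_le) blast

section \<open>Strategies of the defender and closed families of positions\<close>

text \<open>Answers inside \<open>F\<close> are fixed by choice; folding them over the attack
  history gives a strategy that never leaves \<open>F\<close>.\<close>

lemma (in graph) obtain_m_eternal_dominating_set:
  assumes "guardable (adj G) (verts G) k"
  obtains D where "m_eternal_dominating_set G D" "card D = k"
proof -
  obtain F where F: "F \<noteq> {}" "\<And>D. D \<in> F \<Longrightarrow> D \<subseteq> verts G \<and> finite D \<and> card D = k"
    "\<And>D r. D \<in> F \<Longrightarrow> r \<in> verts G \<Longrightarrow>
      \<exists>D'\<in>F. r \<in> D' \<and> rel_mset (stay_or_step (adj G)) (mset_set D) (mset_set D')"
    by (rule guardableE[OF assms]) (rule that)
  obtain D\<^sub>1 where D\<^sub>1: "D\<^sub>1 \<in> F" using F(1) by blast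
  have move: "\<exists>D'\<in>F. r \<in> D' \<and> guard_move G D D'" if "D \<in> F" "r \<in> verts G" for D r
  proof -
    have fin: "finite X" if "X \<in> F" for X using F(2)[OF that] by blast
    show ?thesis
      using F(3)[OF that] unfolding guard_move_iff_rel_mset[OF fin[OF that(1)]] using fin by auto
  qed
  \<comment> \<open>An attack on an unguarded \<open>v\<close> reveals a neighbour of
    \<open>v\<close> in \<open>D\<close>, namely the place of the guard that answers.\<close>
  have dominating: "dominating_set G D" if D: "D \<in> F" for D
    unfolding dominating_set_def
  proof (intro conjI ballI)
    show "D \<subseteq> verts G" using F(2)[OF D] by blast
    fix v assume v: "v \<in> verts G - D"
    then obtain D' f where "v \<in> D'" "bij_betw f D D'" "\<forall>u\<in>D. f u = u \<or> u \<rightarrow>\<^bsub>G\<^esub> f u"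
      using move[OF D, of v] unfolding guard_move_def by auto
    then obtain u where "u \<in> D" "f u = v" unfolding bij_betw_def by blast
    then show "\<exists>u\<in>D. v \<rightarrow>\<^bsub>G\<^esub> u"
      using v \<open>\<forall>u\<in>D. _\<close> by (metis DiffD2 graph_symmetric)
  qed
  \<comment> \<open>The default \<open>D\<close> for attacks outside the graph keeps
    \<open>\<sigma>\<close> in \<open>F\<close> for every list of attacks, legal or not.\<close>
  define next_pos where "next_pos D r =
    (if r \<in> verts G then SOME D'. D' \<in> F \<and> r \<in> D' \<and> guard_move G D D' else D)" for D r
  have next_pos: "next_pos D r \<in> F \<and> r \<in> next_pos D r \<and> guard_move G D (next_pos D r)"
    if "D \<in> F" "r \<in> verts G" for D r
    using someI_ex[of "\<lambda>D'. D' \<in> F \<and> r \<in> D' \<and> guard_move G D D'"] move[OF that] that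
    unfolding next_pos_def by auto
  define \<sigma> where "\<sigma> = foldl next_pos D\<^sub>1"
  have \<sigma>: "\<sigma> xs \<in> F" for xs
  proof (induction xs rule: rev_induct)
    case (snoc r xs)
    then show ?case using next_pos[of "\<sigma> xs" r] by (auto simp: \<sigma>_def next_pos_def)
  qed (simp add: \<sigma>_def D\<^sub>1)
  have "\<sigma> (map r [0..<Suc i]) = next_pos (\<sigma> (map r [0..<i])) (r i)" for r i
    by (simp add: \<sigma>_def)
  then have "m_eternal_dominating_set G D\<^sub>1"
    unfolding m_eternal_dominating_set_def Let_def
    using \<sigma> dominating next_pos by (intro exI[of _ \<sigma>]) (auto simp: \<sigma>_def)
  then show thesis using that F(2)[OF D\<^sub>1] by blast
qed

text \<open>The positions reached by legal attack histories form a closed family: an answer extends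
  the history by one attack, and moves preserve the number of guards.\<close>

lemma (in graph) m_eternal_dominating_set_imp_multi_guardable:
  assumes "m_eternal_dominating_set G D"
  shows "multi_guardable (adj G) (verts G) (card D)"
proof -
  obtain \<sigma> :: "'a list \<Rightarrow> 'a set" where \<sigma>: "\<sigma> [] = D"
    and strategy: "\<And>r i. (\<forall>j < i. r j \<in> verts G - \<sigma> (map r [0..<j])) \<Longrightarrow>
      dominating_set G (\<sigma> (map r [0..<i])) \<and>
      (r i \<in> verts G - \<sigma> (map r [0..<i]) \<longrightarrow>
        guard_move G (\<sigma> (map r [0..<i])) (\<sigma> (map r [0..<Suc i])) \<and> r i \<in> \<sigma> (map r [0..<Suc i]))"
    using assms unfolding m_eternal_dominating_set_def Let_def by blast
  define legal where "legal r i \<longleftrightarrow> (\<forall>j < i. r j \<in> verts G - \<sigma> (map r [0..<j]))" for r i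
  define F where "F = {mset_set (\<sigma> (map r [0..<i])) | r i. legal r i}"
  have pos: "\<sigma> (map r [0..<i]) \<subseteq> verts G" "finite (\<sigma> (map r [0..<i]))" if "legal r i" for r i
    using strategy[of i r] that finite_subset[OF _ finite_verts]
    unfolding legal_def dominating_set_def by blast+
  have card: "card (\<sigma> (map r [0..<i])) = card D" if "legal r i" for r i
    using that
  proof (induction i)
    case 0
    then show ?case by (simp add: \<sigma>)
  next
    case (Suc i)
    then have "legal r i" "r i \<in> verts G - \<sigma> (map r [0..<i])" by (auto simp: legal_def)
    then have "guard_move G (\<sigma> (map r [0..<i])) (\<sigma> (map r [0..<Suc i]))"
      using strategy[of i r] by (auto simp: legal_def)
    then show ?case
      using Suc.IH[OF \<open>legal r i\<close>] bij_betw_same_card unfolding guard_move_def by metis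
  qed
  show ?thesis
  proof (rule multi_guardableI[of F])
    have "legal r 0" for r by (simp add: legal_def)
    then show "F \<noteq> {}" unfolding F_def by blast
  next
    fix M assume "M \<in> F"
    then obtain r i where M: "M = mset_set (\<sigma> (map r [0..<i]))" "legal r i"
      unfolding F_def by blast
    then show "set_mset M \<subseteq> verts G \<and> size M = card D"
      using pos[of r i] card[of r i] by simp
    fix v assume v: "v \<in> verts G"
    show "\<exists>M'\<in>F. v \<in># M' \<and> rel_mset (stay_or_step (adj G)) M M'"
    proof (cases "v \<in> \<sigma> (map r [0..<i])")
      \<comment> \<open>Attacking a guarded vertex is not legal in the original game; here all
        guards stay.\<close>
      case True
      have "rel_mset (stay_or_step (adj G)) M M" by (rule multiset.rel_refl) simp
      moreover have "v \<in># M" using True M pos(2)[of r i] by simp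
      ultimately show ?thesis using \<open>M \<in> F\<close> by blast
    next
      case False
      \<comment> \<open>The attack at index \<open>i\<close> is replaced by \<open>v\<close>. The
        position before it depends on earlier attacks only and is unchanged.\<close>
      define r' where "r' = r(i := v)"
      have same: "map r' [0..<j] = map r [0..<j]" if "j \<le> i" for j
        using that by (auto simp: r'_def)
      have "legal r' i" using M(2) same unfolding legal_def by (simp add: r'_def)
      moreover have r'i: "r' i \<in> verts G - \<sigma> (map r' [0..<i])"
        unfolding same[OF order.refl] using v False by (simp add: r'_def)
      ultimately have legal': "legal r' (Suc i)" unfolding legal_def by (auto simp: less_Suc_eq)
      have "guard_move G (\<sigma> (map r' [0..<i])) (\<sigma> (map r' [0..<Suc i]))"
        "r' i \<in> \<sigma> (map r' [0..<Suc i])"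
        using strategy[of i r'] \<open>legal r' i\<close> r'i unfolding legal_def by blast+
      moreover have "\<sigma> (map r' [0..<i]) = \<sigma> (map r [0..<i])" using same[OF order.refl] by (rule arg_cong)
      ultimately have "rel_mset (stay_or_step (adj G)) M (mset_set (\<sigma> (map r' [0..<Suc i])))"
        "v \<in># mset_set (\<sigma> (map r' [0..<Suc i]))"
        using guard_move_iff_rel_mset[OF pos(2)[OF M(2)], of G] M(1) pos(2)[OF legal']
        by (auto simp: r'_def simp del: upt_Suc)
      then show ?thesis using legal' unfolding F_def by blast
    qed
  qed
qed

lemma (in graph) guardable_clique_covering_number:
  "guardable (adj G) (verts G) (\<theta> G)"
proof -
  obtain P where P: "clique_cover G P" "card P = \<theta> G" by (rule obtain_minimum_clique_cover)
  then have "guardable (adj G) (verts G) (card P)"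
    using finite_clique_cover unfolding clique_cover_iff
    by (intro guardable_clique_partition) blast+
  then show ?thesis using P(2) by simp
qed

lemma (in graph) m_eternal_domination_number_le_clique_covering_number:
  "\<gamma>\<^sub>m\<^sup>\<infinity> G \<le> \<theta> G"
  using obtain_m_eternal_dominating_set[OF guardable_clique_covering_number]
    m_eternal_domination_number_le by metis

text \<open>A minimum clique cover yields some m-eternal dominating set, so the least size is
  attained, and a set attaining it also defends in the relaxed game.\<close>

lemma (in graph) multi_guardable_m_eternal_domination_number:
  "multi_guardable (adj G) (verts G) (\<gamma>\<^sub>m\<^sup>\<infinity> G)"
proof -
  obtain D where "m_eternal_dominating_set G D"
    using guardable_clique_covering_number by (rule obtain_m_eternal_dominating_set)
  then have "\<exists>k D. m_eternal_dominating_set G D \<and> card D = k" by blast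
  then have "\<exists>D. m_eternal_dominating_set G D \<and> card D = \<gamma>\<^sub>m\<^sup>\<infinity> G"
    unfolding m_eternal_domination_number_def by (rule LeastI_ex)
  then show ?thesis using m_eternal_dominating_set_imp_multi_guardable by metis
qed

section \<open>R2 steps and the lower bound\<close>

text \<open>Without parallel arcs, distinct arcs leaving \<open>v\<close> have distinct
  heads.\<close>

lemma (in graph) out_degree_eq_card_adj: "out_degree G v = card {u. v \<rightarrow>\<^bsub>G\<^esub> u}"
proof -
  have "{u. v \<rightarrow>\<^bsub>G\<^esub> u} = head G ` out_arcs G v" by (auto simp: arcs_ends_conv)
  moreover have "inj_on (head G) (out_arcs G v)"
    by (auto intro!: inj_onI no_multi_arcs simp: arc_to_ends_def)
  ultimately show ?thesis by (simp add: out_degree_def card_image)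
qed

text \<open>Names the second neighbour \<open>z\<close> of the stem and turns degrees into explicit
  neighbourhoods, the form in which \<open>multi_guardable_remove_pendant_path\<close>
  applies.\<close>

lemma (in graph) R2_cases:
  assumes "R2 G G'"
  obtains x y z where "x \<in> verts G" "y \<in> verts G" "z \<in> verts G" "x \<noteq> y" "x \<noteq> z" "y \<noteq> z"
    "\<And>u. y \<rightarrow>\<^bsub>G\<^esub> u \<longleftrightarrow> u = x" "\<And>u. x \<rightarrow>\<^bsub>G\<^esub> u \<longleftrightarrow> u = y \<or> u = z"
    "G' = G \<restriction> (verts G - {x, y})"
  using assms
proof cases
  case (R2 x y)
  have xy: "x \<rightarrow>\<^bsub>G\<^esub> y" "leaf G y" using R2(4) by auto
  have "card {u. y \<rightarrow>\<^bsub>G\<^esub> u} = 1" using xy(2) by (simp add: leaf_def out_degree_eq_card_adj)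
  moreover have "y \<rightarrow>\<^bsub>G\<^esub> x" using xy(1) by (rule graph_symmetric)
  ultimately have y: "{u. y \<rightarrow>\<^bsub>G\<^esub> u} = {x}"
    by (metis card_1_singletonE mem_Collect_eq singletonD)
  have "card {u. x \<rightarrow>\<^bsub>G\<^esub> u} = 2" using R2(3) by (simp add: out_degree_eq_card_adj)
  then obtain a b where ab: "{u. x \<rightarrow>\<^bsub>G\<^esub> u} = {a, b}" "a \<noteq> b" unfolding card_2_iff by blast
  moreover have "y \<in> {u. x \<rightarrow>\<^bsub>G\<^esub> u}" using xy(1) by simp
  ultimately have "y = a \<or> y = b" by simp
  then obtain z where z: "{u. x \<rightarrow>\<^bsub>G\<^esub> u} = {y, z}" "y \<noteq> z"
    using ab that[of a] that[of b] by (auto simp: insert_commute)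
  have xz: "x \<rightarrow>\<^bsub>G\<^esub> z" using z(1) by blast
  have "x \<noteq> y" "x \<noteq> z" using xy(1) xz adj_not_same by metis+
  moreover have "x \<in> verts G" "y \<in> verts G" "z \<in> verts G"
    using adj_in_verts[OF xy(1)] adj_in_verts[OF xz] by simp_all
  moreover have "\<And>u. y \<rightarrow>\<^bsub>G\<^esub> u \<longleftrightarrow> u = x" "\<And>u. x \<rightarrow>\<^bsub>G\<^esub> u \<longleftrightarrow> u = y \<or> u = z"
    using y z(1) by (simp_all add: set_eq_iff)
  ultimately show thesis using z(2) R2(1) by (intro that[of x y z])
qed

text \<open>Induction backwards along the R2 steps, carrying the cover and the bound for the relaxed
  game together. Undoing a step adds the single block \<open>{x, y}\<close>, while any number of
  guards that suffices for \<open>G\<close> can be lowered by one for \<open>G'\<close>.\<close>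

lemma reducible_imp_clique_cover_le:
  assumes "R2\<^sup>*\<^sup>* G S" "r \<in> {1, 2}" "complete_bipartite_digraph 1 r S" "graph G"
  shows "\<exists>P. clique_cover G P \<and> (\<forall>k. multi_guardable (adj G) (verts G) k \<longrightarrow> card P \<le> k)"
  using assms(1,4)
proof (induction rule: converse_rtranclp_induct)
  case base
  then interpret graph S .
  obtain U W where UW: "verts S = U \<union> W" "U \<inter> W = {}" "card U = 1" "card W = r"
    "arcs_ends S = U \<times> W \<union> W \<times> U"
    using assms(3) unfolding complete_bipartite_digraph_def by blast
  obtain a where a: "U = {a}" using UW(3) card_1_singletonE by blast
  obtain b where b: "b \<in> W" using UW(4) assms(2) by fastforce
  have edges: "a \<rightarrow>\<^bsub>S\<^esub> b" "b \<rightarrow>\<^bsub>S\<^esub> a" using UW(5) a b by auto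
  have ab: "a \<noteq> b" using UW(2) a b by blast
  show ?case
  proof (cases "r = 1")
    case True
    then have W: "W = {b}" using UW(4) b card_1_singletonE by blast
    have "clique_cover S {{a, b}}"
      unfolding clique_cover_iff using UW(1) a W edges by (auto simp: partition_on_def disjoint_def)
    moreover have "1 \<le> k" if "multi_guardable (adj S) (verts S) k" for k
    proof -
      from that obtain F where F: "F \<noteq> {}" "\<And>M. M \<in> F \<Longrightarrow> set_mset M \<subseteq> verts S \<and> size M = k"
        "\<And>M r. M \<in> F \<Longrightarrow> r \<in> verts S \<Longrightarrow> \<exists>M'\<in>F. r \<in># M' \<and> rel_mset (stay_or_step (adj S)) M M'"
        by (rule multi_guardableE) (rule that)
      obtain M where "M \<in> F" "a \<in># M" using F(1) F(3)[of _ a] UW(1) a by blast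
      then show ?thesis using F(2)[of M] by (cases k) auto
    qed
    ultimately show ?thesis by (intro exI[of _ "{{a, b}}"]) simp
  next
    case False
    then have "card W = 2" using assms(2) UW(4) by simp
    then obtain c where W: "W = {b, c}" "b \<noteq> c" using b unfolding card_2_iff by blast
    have ac: "a \<noteq> c" using UW(2) a W by blast
    have bc: "\<not> b \<rightarrow>\<^bsub>S\<^esub> c" using UW(5) a W ab ac by auto
    have "clique_cover S {{a, b}, {c}}"
      unfolding clique_cover_iff using UW(1) a W edges ac
      by (auto simp: partition_on_def disjoint_def)
    moreover have "2 \<le> k" if "multi_guardable (adj S) (verts S) k" for k
    proof -
      from that obtain F where F: "F \<noteq> {}" "\<And>M. M \<in> F \<Longrightarrow> set_mset M \<subseteq> verts S \<and> size M = k"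
        "\<And>M r. M \<in> F \<Longrightarrow> r \<in> verts S \<Longrightarrow> \<exists>M'\<in>F. r \<in># M' \<and> rel_mset (stay_or_step (adj S)) M M'"
        by (rule multi_guardableE) (rule that)
      obtain M where M: "M \<in> F" "b \<in># M" using F(1) F(3)[of _ b] UW(1) W by blast
      obtain M' where M': "M' \<in> F" "c \<in># M'" "rel_mset (stay_or_step (adj S)) M M'"
        using F(3)[OF M(1), of c] UW(1) W by blast
      have "k \<noteq> 0" using F(2)[OF M(1)] M(2) by (metis empty_iff set_mset_empty size_eq_0_iff_empty)
      moreover have "k \<noteq> 1"
      proof
        \<comment> \<open>A lone guard on the leaf \<open>b\<close> would have to step directly to
          the other leaf \<open>c\<close>.\<close>
        assume "k = 1"
        then have "size M = 1" "size M' = 1" using F(2) M(1) M'(1) by simp_all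
        then have "M = {#b#}" "M' = {#c#}"
          using M(2) M'(2) size_1_singleton_mset by fastforce+
        then show False using M'(3) msed_rel_invL[of _ b "{#}" "{#c#}"] W(2) bc by auto
      qed
      ultimately show ?thesis by simp
    qed
    moreover have "card {{a, b}, {c}} = 2" using ac by auto
    ultimately show ?thesis by (intro exI[of _ "{{a, b}, {c}}"]) simp
  qed
next
  case (step G G')
  interpret graph G by (rule step.prems)
  obtain x y z where xyz: "x \<in> verts G" "y \<in> verts G" "z \<in> verts G" "x \<noteq> y" "x \<noteq> z" "y \<noteq> z"
    and Ey: "\<And>u. y \<rightarrow>\<^bsub>G\<^esub> u \<longleftrightarrow> u = x" and Ex: "\<And>u. x \<rightarrow>\<^bsub>G\<^esub> u \<longleftrightarrow> u = y \<or> u = z"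
    and G': "G' = G \<restriction> (verts G - {x, y})"
    by (rule R2_cases[OF step.hyps(1)]) (rule that)
  have "graph G'" unfolding G' by (rule graph_induce_subgraph) blast
  then obtain P where P: "clique_cover G' P"
    "\<And>k. multi_guardable (adj G') (verts G') k \<Longrightarrow> card P \<le> k"
    using step.IH by blast
  have part: "partition_on (verts G - {x, y}) P"
    and cliques: "\<forall>W\<in>P. \<forall>u\<in>W. \<forall>v\<in>W. u \<noteq> v \<longrightarrow> u \<rightarrow>\<^bsub>G'\<^esub> v"
    using P(1) unfolding graph.clique_cover_iff[OF \<open>graph G'\<close>] by (auto simp: G')
  have "partition_on (verts G) (insert {x, y} P)"
    using part xyz by (subst partition_on_insert) (auto simp: partition_on_def disjnt_def)
  then have cover: "clique_cover G (insert {x, y} P)"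
    unfolding clique_cover_iff using cliques Ex Ey by (auto simp: G' dominates_induce_iff)
  have "card (insert {x, y} P) \<le> k" if "multi_guardable (adj G) (verts G) k" for k
  proof -
    from that obtain k' where k': "k = Suc k'" "multi_guardable (adj G) (verts G - {x, y}) k'"
      using multi_guardable_remove_pendant_path[of "adj G" "verts G" k x y z]
        graph_symmetric xyz Ex Ey by blast
    \<comment> \<open>All positions avoid \<open>x\<close> and \<open>y\<close>, so the moves use
      only edges of the induced subgraph.\<close>
    have "multi_guardable (adj G') (verts G') k'"
    proof -
      obtain F where F: "F \<noteq> {}"
        "\<And>M. M \<in> F \<Longrightarrow> set_mset M \<subseteq> verts G - {x, y} \<and> size M = k'"
        "\<And>M r. M \<in> F \<Longrightarrow> r \<in> verts G - {x, y} \<Longrightarrow>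
          \<exists>M'\<in>F. r \<in># M' \<and> rel_mset (stay_or_step (adj G)) M M'"
        by (rule multi_guardableE[OF k'(2)]) (rule that)
      have "rel_mset (stay_or_step (adj G')) M M'"
        if "M \<in> F" "M' \<in> F" "rel_mset (stay_or_step (adj G)) M M'" for M M'
        using F(2)[OF that(1)] F(2)[OF that(2)]
        by (intro multiset.rel_mono_strong[OF that(3)]) (auto simp: G' dominates_induce_iff)
      then show ?thesis using F by (intro multi_guardableI[of F]) (simp_all add: G', blast)
    qed
    then have "card P \<le> k'" by (rule P(2))
    then show ?thesis using k'(1) card_insert_le_m1[of "Suc k'" P "{x, y}"] by simp
  qed
  then show ?case using cover by blast
qed

subsection \<open>Trees\<close>

text \<open>Acyclicity in local form: every edge is a tree edge, so adjacent vertices of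
  \<open>V\<close> lie on consecutive levels.\<close>

definition rooted_tree :: "('a \<Rightarrow> 'a \<Rightarrow> bool) \<Rightarrow> 'a set \<Rightarrow> 'a \<Rightarrow> ('a \<Rightarrow> 'a) \<Rightarrow> ('a \<Rightarrow> nat) \<Rightarrow> bool" where
  "rooted_tree E V s p d \<longleftrightarrow> rooted_at E V s p d \<and>
     (\<forall>u v. E u v \<longrightarrow> u \<noteq> s \<and> v = p u \<or> v \<noteq> s \<and> u = p v)"

text \<open>Breadth-first search: \<open>d\<close> is the distance from \<open>s\<close>, and
  \<open>p\<close> picks a predecessor on a shortest walk.\<close>

lemma obtain_rooted_at:
  assumes "finite V" "s \<in> V"
    and sym: "\<And>u v. E u v \<Longrightarrow> E v u" and E_V: "\<And>u v. E u v \<Longrightarrow> u \<in> V \<and> v \<in> V"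
    and conn: "\<And>v. v \<in> V \<Longrightarrow> E\<^sup>*\<^sup>* s v"
  obtains p d where "rooted_at E V s p d"
proof -
  define d where "d v = (LEAST n. (E ^^ n) s v)" for v
  have path: "(E ^^ d v) s v" if "v \<in> V" for v
    unfolding d_def by (rule LeastI_ex) (use conn[OF that] in \<open>simp add: rtranclp_power\<close>)
  have d_le: "d v \<le> n" if "(E ^^ n) s v" for v n
    unfolding d_def using that by (rule Least_le)
  have "d s = 0" using d_le[of 0 s] by simp
  have "\<exists>w. E w v \<and> d v = Suc (d w)" if v: "v \<in> V" "v \<noteq> s" for v
  proof -
    obtain n where n: "d v = Suc n" using path[OF v(1)] v(2) by (cases "d v") auto
    then obtain w where w: "(E ^^ n) s w" "E w v"
      using path[OF v(1)] by (metis relpowp_Suc_E)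
    have "w \<in> V" using w(2) E_V by blast
    then have "(E ^^ Suc (d w)) s v" using path[of w] w(2) by (blast intro: relpowp_Suc_I)
    then have "d v \<le> Suc (d w)" by (rule d_le)
    moreover have "d w \<le> n" using w(1) by (rule d_le)
    ultimately show ?thesis using n w(2) by auto
  qed
  then obtain p where "\<And>v. v \<in> V \<Longrightarrow> v \<noteq> s \<Longrightarrow> E (p v) v \<and> d v = Suc (d (p v))" by metis
  then have "rooted_at E V s p d"
    unfolding rooted_at_def using assms(1,2) \<open>d s = 0\<close> sym E_V by blast
  then show thesis by (rule that)
qed

text \<open>
  An edge \<open>u v\<close> outside the breadth-first tree would close a cycle: the tree edges alone
  already connect \<open>u\<close> to \<open>v\<close>.
\<close>

lemma undirected_tree_obtain_rooted_tree:
  assumes "undirected_tree G" "s \<in> verts G"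
  obtains p d where "rooted_tree (adj G) (verts G) s p d"
proof -
  interpret graph G using assms(1) unfolding undirected_tree_def by blast
  have "strongly_connected G"
    using assms(1) sym_arcs symmetric_connected_imp_strongly_connected
    unfolding undirected_tree_def by blast
  then have conn: "(adj G)\<^sup>*\<^sup>* s v" if "v \<in> verts G" for v
    using that assms(2) reachable_rtranclI[of G s v] unfolding strongly_connected_def
    by (auto simp: rtranclp_rtrancl_eq)
  obtain p d where pd: "rooted_at (adj G) (verts G) s p d"
    by (rule obtain_rooted_at[of "verts G" s "adj G"])
      (use assms(2) graph_symmetric adj_in_verts conn in auto)
  have parent: "p v \<in> verts G" "v \<rightarrow>\<^bsub>G\<^esub> p v" "p v \<rightarrow>\<^bsub>G\<^esub> v" "d v = Suc (d (p v))"
    if "v \<in> verts G" "v \<noteq> s" for v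
    using pd that unfolding rooted_at_def by blast+
  have "u \<noteq> s \<and> v = p u \<or> v \<noteq> s \<and> u = p v" if uv: "u \<rightarrow>\<^bsub>G\<^esub> v" for u v
  proof (rule ccontr)
    assume non_tree: "\<not> ?thesis"
    \<comment> \<open>Both arcs of the offending edge are deleted; all tree edges survive, so
      \<open>H\<close> still connects every vertex to \<open>s\<close>.\<close>
    define H where "H = G\<lparr>arcs := {a \<in> arcs G. arc_to_ends G a \<notin> {(u, v), (v, u)}}\<rparr>"
    have H: "verts H = verts G" "tail H = tail G" "head H = head G"
      "arcs H = {a \<in> arcs G. arc_to_ends G a \<notin> {(u, v), (v, u)}}"
      by (simp_all add: H_def)
    interpret H: wf_digraph H by unfold_locales (auto simp: H)
    have H_adj: "a \<rightarrow>\<^bsub>H\<^esub> b \<longleftrightarrow> a \<rightarrow>\<^bsub>G\<^esub> b \<and> (a, b) \<notin> {(u, v), (v, u)}" for a b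
      unfolding arcs_ends_def arc_to_ends_def by (auto simp: H arc_to_ends_def)
    have tree_edge: "w \<rightarrow>\<^bsub>H\<^esub> p w" "p w \<rightarrow>\<^bsub>H\<^esub> w" if "w \<in> verts G" "w \<noteq> s" for w
      using parent[OF that] non_tree that unfolding H_adj by auto
    have to_root: "w \<rightarrow>\<^sup>*\<^bsub>H\<^esub> s \<and> s \<rightarrow>\<^sup>*\<^bsub>H\<^esub> w" if "w \<in> verts G" for w
      using that
    proof (induction "d w" arbitrary: w rule: less_induct)
      case less
      show ?case
      proof (cases "w = s")
        case True
        then show ?thesis using assms(2) by (simp add: H)
      next
        case False
        then have "p w \<rightarrow>\<^sup>*\<^bsub>H\<^esub> s \<and> s \<rightarrow>\<^sup>*\<^bsub>H\<^esub> p w" using less parent by simp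
        then show ?thesis
          using tree_edge[OF less.prems False] H.adj_reachable_trans H.reachable_adj_trans by blast
      qed
    qed
    have "u \<in> verts G" "v \<in> verts G" using uv adj_in_verts by blast+
    then have "u \<rightarrow>\<^sup>*\<^bsub>H\<^esub> v" using to_root H.reachable_trans by blast
    then obtain q where "H.apath u q v" unfolding H.reachable_apath by blast
    then have q: "set q \<subseteq> arcs H" "cas u q v" "distinct (awalk_verts u q)"
      using compatible_cas[of H G] compatible_awalk_verts[of H G]
      by (auto simp: H.apath_def H.awalk_def compatible_def H)
    \<comment> \<open>Length 0 would mean \<open>u = v\<close>, and length 1 would use the deleted
      edge. Hence closing \<open>q\<close> by an arc from \<open>v\<close> to \<open>u\<close> gives
      a cycle of length at least 3.\<close>
    have "length q \<ge> 2"
    proof (rule ccontr)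
      assume "\<not> length q \<ge> 2"
      then consider "q = []" | a where "q = [a]" by (cases q; cases "tl q") auto
      then show False
      proof cases
        case 1
        then show False using q(2) uv adj_not_same by auto
      next
        case 2
        then show False using q by (auto simp: H arc_to_ends_def)
      qed
    qed
    obtain e where e: "e \<in> arcs G" "tail G e = v" "head G e = u"
      using graph_symmetric[OF uv] by (rule reachableE)
    have "awalk v (e # q) v"
      using q(1,2) e \<open>v \<in> verts G\<close> by (auto simp: awalk_def H)
    moreover have "distinct (tl (awalk_verts v (e # q)))" using q(3) e by simp
    ultimately have "cycle (e # q)" unfolding cycle_def by blast
    moreover have "length (e # q) \<ge> 3" using \<open>length q \<ge> 2\<close> by simp
    ultimately show False using assms(1) unfolding undirected_tree_def by blast
  qed
  with pd have "rooted_tree (adj G) (verts G) s p d" unfolding rooted_tree_def by blast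
  then show thesis by (rule that)
qed

text \<open>Adjacent vertices differ in depth by exactly one, which cannot hold for all pairs among
  three vertices.\<close>

lemma rooted_tree_clique_card:
  assumes "rooted_tree E V s p d" "W \<subseteq> V" "\<And>u v. u \<in> W \<Longrightarrow> v \<in> W \<Longrightarrow> u \<noteq> v \<Longrightarrow> E u v"
  shows "card W \<le> 2"
proof (rule ccontr)
  assume "\<not> card W \<le> 2"
  then have "3 \<le> card W" by simp
  then obtain X where X: "X \<subseteq> W" "card X = 3" by (rule obtain_subset_with_card_n)
  then obtain a b c where abc: "X = {a, b, c}" "a \<noteq> b" "b \<noteq> c" "a \<noteq> c" unfolding card_3_iff by blast
  have step: "d u = Suc (d v) \<or> d v = Suc (d u)" if "u \<in> W" "v \<in> W" "u \<noteq> v" for u v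
    using assms(1) assms(2) assms(3)[OF that] that unfolding rooted_tree_def rooted_at_def by blast
  have "d a = Suc (d b) \<or> d b = Suc (d a)" "d b = Suc (d c) \<or> d c = Suc (d b)"
    "d a = Suc (d c) \<or> d c = Suc (d a)"
    using step X(1) abc by auto
  then show False by linarith
qed

section \<open>From a small clique cover to R2 steps\<close>

text \<open>Blocks have one or two elements, so \<open>2 * card P\<close> exceeds
  \<open>card V\<close> by the number of singletons, which is therefore at most one. The exceptional
  vertex \<open>s\<close> is the root chosen later.\<close>

lemma small_partition_single_exception:
  assumes "partition_on V P" "finite P" "V \<noteq> {}" "\<And>W. W \<in> P \<Longrightarrow> card W \<le> 2 \<and> finite W"
    "2 * card P \<le> card V + 1"
  obtains s where "s \<in> V" "\<And>W. W \<in> P \<Longrightarrow> card W = 2 \<or> W = {s}"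
proof -
  have pos: "card W \<ge> 1" if "W \<in> P" for W
    using that assms(1,4) by (metis One_nat_def Suc_leI card_gt_0_iff partition_onD3)
  define Q where "Q = {W \<in> P. card W = 1}"
  have "card V = (\<Sum>W\<in>P. card W)"
    using assms by (metis card_Union_disjoint partition_onD1 partition_onD2)
  \<comment> \<open>Since \<open>card W\<close> is at most 2, the truncated difference
    \<open>2 - card W\<close> is the true deficit of the block.\<close>
  moreover have "2 * card P = (\<Sum>W\<in>P. card W + (2 - card W))"
    using assms(4) by simp
  moreover have "card Q \<le> (\<Sum>W\<in>P. 2 - card W)"
  proof -
    have "card Q = (\<Sum>W\<in>Q. 2 - card W)" by (simp add: Q_def)
    also have "\<dots> \<le> (\<Sum>W\<in>P. 2 - card W)" by (rule sum_mono2) (auto simp: Q_def assms(2))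
    finally show ?thesis .
  qed
  ultimately have "card Q \<le> 1" using assms(5) by (simp add: sum.distrib)
  have "finite Q" using assms(2) by (simp add: Q_def)
  have cases: "card W = 2 \<or> W \<in> Q" if "W \<in> P" for W
    using pos[OF that] assms(4)[OF that] that unfolding Q_def by (simp, linarith)
  show thesis
  proof (cases "Q = {}")
    \<comment> \<open>Without a singleton any vertex serves as \<open>s\<close>.\<close>
    case True
    obtain s where "s \<in> V" using assms(3) by blast
    then show thesis using that[of s] cases True by blast
  next
    case False
    then obtain s where s: "{s} \<in> Q" unfolding Q_def by (auto simp: card_1_singleton_iff)
    then have "W = {s}" if "W \<in> Q" for W
      using that \<open>card Q \<le> 1\<close> \<open>finite Q\<close> by (metis One_nat_def card_le_Suc0_iff_eq)
    moreover have "s \<in> V" using s assms(1) unfolding Q_def partition_on_def by blast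
    ultimately show thesis using that[of s] cases by blast
  qed
qed

lemma complete_bipartite_starI:
  assumes "graph G" "verts G = insert x L" "x \<notin> L" "card L = r"
    and "\<And>u v. u \<rightarrow>\<^bsub>G\<^esub> v \<longleftrightarrow> u = x \<and> v \<in> L \<or> u \<in> L \<and> v = x"
  shows "complete_bipartite_digraph 1 r G"
proof -
  have "arcs_ends G = {x} \<times> L \<union> L \<times> {x}" using assms(5) by auto
  then show ?thesis
    unfolding complete_bipartite_digraph_def using assms(1-4)
    by (intro conjI[OF assms(1)]) (rule exI[of _ "{x}"], rule exI[of _ L], simp)
qed

text \<open>
  A deepest vertex \<open>y\<close> is matched to its parent \<open>x\<close>, which therefore has no other child;
  so either R2 removes \<open>x\<close> and \<open>y\<close>, or at most one further vertex is left.
\<close>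

lemma rooted_tree_reducible:
  assumes "graph G" "rooted_tree (adj G) (verts G) s p d" "clique_cover G P"
    and "\<And>W. W \<in> P \<Longrightarrow> card W = 2 \<or> W = {s}" and "card (verts G) \<ge> 2"
  shows "\<exists>S. R2\<^sup>*\<^sup>* G S \<and> (\<exists>r\<in>{1, 2}. complete_bipartite_digraph 1 r S)"
  using assms
proof (induction "card (verts G)" arbitrary: G P rule: less_induct)
  case less
  interpret graph G by (rule less.prems)
  have rooted: "rooted_at (adj G) (verts G) s p d"
    and edge: "\<And>u v. u \<rightarrow>\<^bsub>G\<^esub> v \<Longrightarrow> u \<noteq> s \<and> v = p u \<or> v \<noteq> s \<and> u = p v"
    using less.prems(2) unfolding rooted_tree_def by blast+
  have root: "s \<in> verts G" "d s = 0" using rooted unfolding rooted_at_def by blast+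
  have parent: "p v \<in> verts G" "v \<rightarrow>\<^bsub>G\<^esub> p v" "p v \<rightarrow>\<^bsub>G\<^esub> v" "d v = Suc (d (p v))"
    if "v \<in> verts G" "v \<noteq> s" for v
    using rooted that unfolding rooted_at_def by blast+
  have part: "partition_on (verts G) P"
    and clique: "\<And>W u v. W \<in> P \<Longrightarrow> u \<in> W \<Longrightarrow> v \<in> W \<Longrightarrow> u \<noteq> v \<Longrightarrow> u \<rightarrow>\<^bsub>G\<^esub> v"
    using less.prems(3) unfolding clique_cover_iff by blast+
  obtain y where y: "y \<in> verts G" "y \<noteq> s" and deepest: "\<And>v. v \<in> verts G \<Longrightarrow> d v \<le> d y"
    using rooted_at_deepest[OF rooted less.prems(5)] by blast
  \<comment> \<open>A vertex of maximal depth has no children, so its parent is its only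
    neighbour.\<close>
  have bottom: "v \<rightarrow>\<^bsub>G\<^esub> u \<longleftrightarrow> u = p v" if v: "v \<in> verts G" "v \<noteq> s" "d v = d y" for u v
  proof
    assume vu: "v \<rightarrow>\<^bsub>G\<^esub> u"
    then have "u \<in> verts G" using adj_in_verts by blast
    show "u = p v"
    proof (rule ccontr)
      assume "u \<noteq> p v"
      then have "u \<noteq> s" "v = p u" using edge[OF vu] by blast+
      then have "d u = Suc (d y)" using parent(4)[OF \<open>u \<in> verts G\<close>] v(3) by simp
      then show False using deepest[OF \<open>u \<in> verts G\<close>] by simp
    qed
  qed (use parent v in simp)
  \<comment> \<open>As \<open>v\<close> is not the root, its block has a second vertex, which is
    adjacent to \<open>v\<close> and hence its parent.\<close>
  have matched: "{v, p v} \<in> P" if v: "v \<in> verts G" "v \<noteq> s" "d v = d y" for v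
  proof -
    obtain W where W: "W \<in> P" "v \<in> W" using v(1) part unfolding partition_on_def by blast
    then have "card W = 2" using less.prems(4)[OF W(1)] v(2) by blast
    then obtain a b where "W = {a, b}" "a \<noteq> b" unfolding card_2_iff by blast
    then obtain u where u: "W = {v, u}" "u \<noteq> v"
      using W(2) that[of a] that[of b] by (auto simp: insert_commute)
    then have "v \<rightarrow>\<^bsub>G\<^esub> u" using clique[OF W(1), of v u] by blast
    then show ?thesis using W(1) u(1) bottom[OF v] by simp
  qed
  define x where "x = p y"
  have x: "x \<in> verts G" and dy: "d y = Suc (d x)" and xy: "x \<noteq> y" "x \<rightarrow>\<^bsub>G\<^esub> y" "y \<rightarrow>\<^bsub>G\<^esub> x"
    using parent[OF y] adj_not_same unfolding x_def by auto
  \<comment> \<open>A second child of \<open>x\<close> would be as deep as \<open>y\<close> and also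
    matched to \<open>x\<close>, but blocks are disjoint.\<close>
  have only_child: "v = y" if v: "v \<in> verts G" "v \<noteq> s" "p v = x" for v
  proof -
    have dv: "d v = d y" using parent(4)[OF v(1,2)] v(3) dy by simp
    have "{v, x} \<in> P" "{y, x} \<in> P" using matched[OF v(1,2) dv] matched[OF y refl] v(3) x_def by auto
    then have "{v, x} = {y, x}" using disjointD[OF partition_onD2[OF part]] by fastforce
    moreover have "v \<noteq> x" using dv dy by auto
    ultimately show ?thesis by blast
  qed
  show ?case
  proof (cases "x = s")
    \<comment> \<open>Every vertex except the root is now a child of the root, so only the edge
      between \<open>x\<close> and \<open>y\<close> is left.\<close>
    case True
    have "v = y" if v: "v \<in> verts G" "v \<noteq> s" for v
    proof -
      have "d (p v) = 0" using deepest[OF v(1)] parent(4)[OF v] dy True root by simp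
      then have "p v = s" using parent(1,4) v by (metis Zero_not_Suc)
      then show ?thesis using only_child[OF v] True by simp
    qed
    then have V: "verts G = {x, y}" using True root(1) y(1) by blast
    have "complete_bipartite_digraph 1 1 G"
    proof (rule complete_bipartite_starI[OF less.prems(1), of x "{y}"])
      fix u v
      have "u \<in> {x, y} \<and> v \<in> {x, y} \<and> u \<noteq> v" if "u \<rightarrow>\<^bsub>G\<^esub> v"
        using adj_in_verts[OF that] adj_not_same[of u] that V by auto
      then show "u \<rightarrow>\<^bsub>G\<^esub> v \<longleftrightarrow> u = x \<and> v \<in> {y} \<or> u \<in> {y} \<and> v = x"
        using xy(2,3) by auto
    qed (use V xy(1) in auto)
    then show ?thesis by blast
  next
    case False
    define z where "z = p x"
    have z: "z \<in> verts G" and dx: "d x = Suc (d z)" and xz: "x \<rightarrow>\<^bsub>G\<^esub> z" "z \<rightarrow>\<^bsub>G\<^esub> x"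
      using parent[OF x False] unfolding z_def by auto
    have neq: "x \<noteq> z" "y \<noteq> z" using dx dy by auto
    have Ey: "y \<rightarrow>\<^bsub>G\<^esub> u \<longleftrightarrow> u = x" for u using bottom[OF y refl] x_def by simp
    have Ex: "x \<rightarrow>\<^bsub>G\<^esub> u \<longleftrightarrow> u = y \<or> u = z" for u
    proof
      assume xu: "x \<rightarrow>\<^bsub>G\<^esub> u"
      then have "u \<in> verts G" using adj_in_verts by blast
      then show "u = y \<or> u = z" using edge[OF xu] only_child z_def by blast
    qed (use xy xz in auto)
    have deg: "out_degree G x = 2" "leaf G y"
      using neq(2) y(1) by (auto simp: out_degree_eq_card_adj leaf_def Ex Ey Collect_disj_eq)
    show ?thesis
    proof (cases "leaf G z")
      \<comment> \<open>Now \<open>x\<close> has two leaves and R2 does not apply. The leaf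
        \<open>z\<close> must be the root, for otherwise its only neighbour \<open>x\<close> would
        be its parent; so the tree is the path \<open>y\<close>, \<open>x\<close>,
        \<open>z\<close>.\<close>
      case True
      then have "card {u. z \<rightarrow>\<^bsub>G\<^esub> u} = 1" by (simp add: leaf_def out_degree_eq_card_adj)
      then have Ez: "u = x" if "z \<rightarrow>\<^bsub>G\<^esub> u" for u
        using that xz(2) by (metis card_1_singletonE mem_Collect_eq singletonD)
      have zs: "z = s"
      proof (rule ccontr)
        assume "z \<noteq> s"
        then have "p z = x" using Ez parent(2)[OF z] by blast
        then show False using parent(4)[OF z \<open>z \<noteq> s\<close>] dx by simp
      qed
      have depth1: "v = x" if v: "v \<in> verts G" "v \<noteq> s" "d (p v) = 0" for v
      proof -
        have "p v = s" using parent(1,4) v by (metis Zero_not_Suc)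
        then show ?thesis using Ez parent(3)[OF v(1,2)] zs by simp
      qed
      have "v = x \<or> v = y" if v: "v \<in> verts G" "v \<noteq> s" for v
      proof (cases "d (p v) = 0")
        case True
        then show ?thesis using depth1 v by blast
      next
        case nonzero: False
        then have "p v \<noteq> s" using root(2) by auto
        have "d (p v) \<le> 1" using deepest[OF v(1)] parent(4)[OF v] dy dx zs root(2) by simp
        then have "d (p (p v)) = 0" using parent(4)[OF parent(1)[OF v] \<open>p v \<noteq> s\<close>] by simp
        then have "p v = x" using depth1[OF parent(1)[OF v] \<open>p v \<noteq> s\<close>] by blast
        then show ?thesis using only_child v by blast
      qed
      then have V: "verts G = {x, y, z}" using zs root(1) x y(1) by blast
      have "complete_bipartite_digraph 1 2 G"
      proof (rule complete_bipartite_starI[OF less.prems(1), of x "{y, z}"])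
        fix u v
        have "u \<in> {x, y, z}" if "u \<rightarrow>\<^bsub>G\<^esub> v" using adj_in_verts[OF that] V by auto
        then show "u \<rightarrow>\<^bsub>G\<^esub> v \<longleftrightarrow> u = x \<and> v \<in> {y, z} \<or> u \<in> {y, z} \<and> v = x"
          using Ex[of v] Ey[of v] Ez[of v] xz(2) neq xy(1) by auto
      qed (use V xy(1) neq in auto)
      then show ?thesis by blast
    next
      case not_leaf: False
      define G' where "G' = G \<restriction> (verts G - {x, y})"
      have R2: "R2 G G'"
        unfolding G'_def
      proof (rule R2.intros)
        show "stem G x" using x xy(2) deg(2) by (auto simp: stem_def)
        show "{u. leaf G u \<and> x \<rightarrow>\<^bsub>G\<^esub> u} = {y}" using deg(2) not_leaf Ex by blast
      qed (rule deg)
      have V': "verts G' = verts G - {x, y}" by (simp add: G'_def)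
      have E': "u \<rightarrow>\<^bsub>G'\<^esub> v \<longleftrightarrow> u \<in> verts G' \<and> v \<in> verts G' \<and> u \<rightarrow>\<^bsub>G\<^esub> v" for u v
        unfolding V' by (simp add: G'_def dominates_induce_iff)
      have "graph G'" unfolding G'_def by (rule graph_induce_subgraph) blast
      have "rooted_tree (adj G') (verts G') s p d"
      proof -
        \<comment> \<open>No surviving vertex loses its parent: \<open>y\<close> has no child, and
          \<open>x\<close> has no child other than \<open>y\<close>.\<close>
        have closed: "p v \<in> verts G'" if "v \<in> verts G'" "v \<noteq> s" for v
        proof -
          have v: "v \<in> verts G" "v \<noteq> x" "v \<noteq> y" using that(1) by (auto simp: V')
          have "p v \<noteq> y" using parent(4)[OF v(1) that(2)] deepest[OF v(1)] by auto
          moreover have "p v \<noteq> x" using only_child v(1,3) that(2) by blast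
          ultimately show ?thesis using parent(1)[OF v(1) that(2)] by (simp add: V')
        qed
        have "v \<rightarrow>\<^bsub>G'\<^esub> p v \<and> p v \<rightarrow>\<^bsub>G'\<^esub> v \<and> d v = Suc (d (p v))" if "v \<in> verts G'" "v \<noteq> s" for v
          using closed[OF that] that parent[of v] unfolding E' by (auto simp: V')
        moreover have "finite (verts G')" "s \<in> verts G'"
          using root(1) False y(2) by (auto simp: V')
        ultimately have "rooted_at (adj G') (verts G') s p d"
          unfolding rooted_at_def using closed root(2) by blast
        then show ?thesis unfolding rooted_tree_def using edge E' by blast
      qed
      moreover have "clique_cover G' (P - {{x, y}})"
      proof -
        have xyP: "{x, y} \<in> P" using matched[OF y refl] by (simp add: x_def insert_commute)
        then have disj: "W \<inter> {x, y} = {}" if "W \<in> P - {{x, y}}" for W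
          using that disjointD[OF partition_onD2[OF part]] by (metis DiffE insertI1)
        have ins: "insert {x, y} (P - {{x, y}}) = P" using xyP by blast
        have "disjnt {x, y} (\<Union>(P - {{x, y}}))" using disj unfolding disjnt_def by blast
        from partition_on_insert[OF this, of "verts G"] have part': "partition_on (verts G') (P - {{x, y}})"
          using part ins by (simp add: V')
        moreover have "u \<rightarrow>\<^bsub>G'\<^esub> v" if "W \<in> P - {{x, y}}" "u \<in> W" "v \<in> W" "u \<noteq> v" for W u v
        proof -
          have "u \<in> verts G'" "v \<in> verts G'" using that part' unfolding partition_on_def by blast+
          then show ?thesis using clique[of W u v] that E' by blast
        qed
        ultimately show ?thesis unfolding graph.clique_cover_iff[OF \<open>graph G'\<close>] by blast
      qed
      moreover have "card (verts G') < card (verts G)"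
        unfolding V' using x by (intro psubset_card_mono) auto
      \<comment> \<open>As \<open>z\<close> is not a leaf, it keeps a neighbour \<open>w\<close>
        other than \<open>x\<close>.\<close>
      moreover have "card (verts G') \<ge> 2"
      proof -
        have "card {u. z \<rightarrow>\<^bsub>G\<^esub> u} \<noteq> 1"
          using not_leaf z by (simp add: leaf_def out_degree_eq_card_adj)
        then have "{u. z \<rightarrow>\<^bsub>G\<^esub> u} \<noteq> {x}" by auto
        then obtain w where w: "z \<rightarrow>\<^bsub>G\<^esub> w" "w \<noteq> x" using xz(2) by blast
        have "w \<noteq> y" using Ey[of z] graph_symmetric[OF w(1)] neq(1) by auto
        moreover have "w \<noteq> z" using w(1) adj_not_same by auto
        moreover have "w \<in> verts G" using adj_in_verts[OF w(1)] by simp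
        ultimately have "{z, w} \<subseteq> verts G'" using w z neq by (auto simp: V')
        moreover have "card {z, w} = 2" using \<open>w \<noteq> z\<close> by auto
        moreover have "finite (verts G')" by (simp add: V')
        ultimately show ?thesis by (metis card_mono)
      qed
      ultimately obtain S where "R2\<^sup>*\<^sup>* G' S" "\<exists>r\<in>{1, 2}. complete_bipartite_digraph 1 r S"
        using less.hyps[of G' "P - {{x, y}}"] \<open>graph G'\<close> less.prems(4) by blast
      then show ?thesis using R2 by (blast intro: converse_rtranclp_into_rtranclp)
    qed
  qed
qed

theorem theorem5p2:
  fixes T :: "('a, 'b) pre_digraph"
  assumes "undirected_tree T" and "card (verts T) \<ge> 2"
  shows "\<gamma>\<^sub>m\<^sup>\<infinity> T = \<theta> T \<longleftrightarrow>
    (\<exists>S. R2\<^sup>*\<^sup>* T S \<and> (\<exists>r \<in> {1, 2}. complete_bipartite_digraph 1 r S))"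
proof
  interpret graph T using assms(1) unfolding undirected_tree_def by blast
  have rooted: "\<exists>p d. rooted_tree (adj T) (verts T) s p d" if "s \<in> verts T" for s
    using undirected_tree_obtain_rooted_tree[OF assms(1) that] by blast
  have nonempty: "verts T \<noteq> {}" using assms(2) by auto
  {
    assume eq: "\<gamma>\<^sub>m\<^sup>\<infinity> T = \<theta> T"
    \<comment> \<open>An arbitrary root suffices for the bound on the number of guards.\<close>
    obtain s p d where tree: "rooted_tree (adj T) (verts T) s p d" using rooted nonempty by blast
    obtain k where k: "2 * k \<le> card (verts T) + 1" "guardable (adj T) (verts T) k"
      using guardable_rooted[of "adj T" "verts T" s p d] tree unfolding rooted_tree_def by metis
    have "\<gamma>\<^sub>m\<^sup>\<infinity> T \<le> k"
      using obtain_m_eternal_dominating_set[OF k(2)] m_eternal_domination_number_le by metis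
    moreover obtain P where P: "clique_cover T P" "card P = \<theta> T"
      by (rule obtain_minimum_clique_cover)
    ultimately have small: "2 * card P \<le> card (verts T) + 1" using k(1) eq by simp
    have part: "partition_on (verts T) P" using P(1) unfolding clique_cover_iff by blast
    have blocks: "card W \<le> 2 \<and> finite W" if "W \<in> P" for W
    proof -
      have "W \<subseteq> verts T" using that part unfolding partition_on_def by blast
      then show ?thesis
        using rooted_tree_clique_card[OF tree, of W] that P(1) finite_subset[OF _ finite_verts]
        unfolding clique_cover_iff by blast
    qed
    obtain t where t: "t \<in> verts T" "\<And>W. W \<in> P \<Longrightarrow> card W = 2 \<or> W = {t}"
      using small_partition_single_exception[OF part finite_clique_cover[OF P(1)] nonempty blocks small]
      by blast
    \<comment> \<open>The tree is rooted anew at the exceptional vertex \<open>t\<close>, so that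
      every vertex other than the root lies in a block of size 2.\<close>
    then obtain p' d' where "rooted_tree (adj T) (verts T) t p' d'" using rooted by blast
    then show "\<exists>S. R2\<^sup>*\<^sup>* T S \<and> (\<exists>r \<in> {1, 2}. complete_bipartite_digraph 1 r S)"
      using graph_axioms P(1) t(2) assms(2) by (intro rooted_tree_reducible)
  }
  assume "\<exists>S. R2\<^sup>*\<^sup>* T S \<and> (\<exists>r \<in> {1, 2}. complete_bipartite_digraph 1 r S)"
  then obtain P where P: "clique_cover T P"
    "\<And>k. multi_guardable (adj T) (verts T) k \<Longrightarrow> card P \<le> k"
    using reducible_imp_clique_cover_le graph_axioms by blast
  \<comment> \<open>Taking \<open>k\<close> to be the m-eternal domination number places
    \<open>card P\<close> between the two numbers.\<close>
  then have "\<theta> T \<le> \<gamma>\<^sub>m\<^sup>\<infinity> T"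
    using clique_covering_number_le multi_guardable_m_eternal_domination_number le_trans by metis
  then show "\<gamma>\<^sub>m\<^sup>\<infinity> T = \<theta> T"
    using m_eternal_domination_number_le_clique_covering_number by simp
qed

end
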